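(* Let $r\ge 2$ be an integer and let $F$ be a graph with chromatic number $\chi(F)=k$. Then $\mathrm{ex}_r(n,\mathcal{S}^rF)\le \mathrm{ex}_r(n,\mathcal{S}^rK_k)+o(n^r)$ as $n\to\infty$.
   Context: For a graph $F$ and an integer $r\ge 2$, the $r$-uniform suspension $\mathcal{S}^rF$ is the $r$-uniform hypergraph obtained from $F$ by adding $r-2$ new vertices and adding all of them to every edge of $F$. For an $r$-uniform hypergraph $\mathcal{F}$, $\mathrm{ex}_r(n,\mathcal{F})$ denotes the maximum number of hyperedges in an $n$-vertex $r$-uniform hypergraph not containing $\mathcal{F}$ as a subhypergraph. $K_k$ is the complete graph on $k$ vertices. *)

theory Defs
  imports Complex_Main "HOL-Library.Landau_Symbols"
begin

datatype 'a hypergraph = Hypergraph (verts: "'a set") (edges: "'a set set")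

definition uniform_hypergraph :: "nat \<Rightarrow> 'a hypergraph \<Rightarrow> bool" where
  "uniform_hypergraph r H \<longleftrightarrow>
     finite (verts H) \<and> (\<forall>e\<in>edges H. e \<subseteq> verts H \<and> card e = r)"

text \<open>A finite simple graph is a 2-uniform hypergraph.\<close>

abbreviation simple_graph :: "'a hypergraph \<Rightarrow> bool" where
  "simple_graph \<equiv> uniform_hypergraph 2"

definition complete_graph :: "nat \<Rightarrow> nat hypergraph" where
  "complete_graph k = Hypergraph {..<k} {e. e \<subseteq> {..<k} \<and> card e = 2}"

definition proper_colouring :: "'a hypergraph \<Rightarrow> nat \<Rightarrow> ('a \<Rightarrow> nat) \<Rightarrow> bool" where
  "proper_colouring F k c \<longleftrightarrow>
     c ` verts F \<subseteq> {..<k} \<and> (\<forall>u v. {u, v} \<in> edges F \<longrightarrow> c u \<noteq> c v)"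

definition chromatic_number :: "'a hypergraph \<Rightarrow> nat" where
  "chromatic_number F = (LEAST k. \<exists>c. proper_colouring F k c)"

text \<open>The new vertices are \<open>Inr 0, \<dots>, Inr (r - 3)\<close>; the definition is only meant for \<open>r \<ge> 2\<close>.\<close>

definition suspension :: "nat \<Rightarrow> 'a hypergraph \<Rightarrow> ('a + nat) hypergraph" where
  "suspension r F =
     Hypergraph (Inl ` verts F \<union> Inr ` {..<r - 2})
       ((\<lambda>e. Inl ` e \<union> Inr ` {..<r - 2}) ` edges F)"

text \<open>\<open>H\<close> is a (not necessarily induced) subhypergraph of \<open>G\<close>, up to isomorphism.\<close>

definition contains_copy :: "'b hypergraph \<Rightarrow> 'a hypergraph \<Rightarrow> bool" where
  "contains_copy G H \<longleftrightarrow>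
     (\<exists>f. inj_on f (verts H) \<and> f ` verts H \<subseteq> verts G \<and> (\<forall>e\<in>edges H. f ` e \<in> edges G))"

text \<open>
  Taking vertices in \<^typ>\<open>nat\<close> loses nothing, since every finite hypergraph is isomorphic to one
  on natural numbers. The set below is finite (edge counts are at most \<open>n choose r\<close>), so its
  \<open>Sup\<close> is its maximum whenever it is nonempty; it is \<open>0\<close> if there is no \<open>H\<close>-free
  hypergraph on \<open>n\<close> vertices, which can only happen when \<open>H\<close> has no edges.
\<close>

definition ex :: "nat \<Rightarrow> nat \<Rightarrow> 'a hypergraph \<Rightarrow> nat" where
  "ex r n H = Sup {card (edges G) | G :: nat hypergraph.
     uniform_hypergraph r G \<and> card (verts G) = n \<and> \<not> contains_copy G H}"

end

theory Submission
  imports Defs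
begin

text \<open>
  A suspended \<open>k\<close>-clique in \<open>H\<close> is an \<open>(r - 2)\<close>-tuple together with a \<open>k\<close>-clique in its link graph.
  If \<open>H\<close> has \<open>\<delta> n\<^sup>k\<^sup>+\<^sup>r\<^sup>-\<^sup>2\<close> of them, one fixed tuple has \<open>\<delta> n\<^sup>k\<close> cliques in its link, and by Erdos's box theorem
  these include all transversals of \<open>k\<close> large sets; colour classes of \<open>F\<close> embed into these sets, so \<open>H\<close>
  contains the suspension of \<open>F\<close>. Hence in a suspension-of-\<open>F\<close>-free \<open>H\<close> almost all vertex sets of a
  fixed large size \<open>m\<close> span no suspended clique, and averaging over these sets bounds the edge
  density of \<open>H\<close> by that of the extremal number at \<open>m\<close>. The densities of extremal numbers decrease to a
  limit, so the density at \<open>m\<close> is close to the density at every \<open>n \<ge> m\<close>.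
\<close>

section \<open>Boxes in dense sets of lists\<close>

lemma in_listset_iff: "xs \<in> listset Ts \<longleftrightarrow> list_all2 (\<in>) xs Ts"
  by (induction Ts arbitrary: xs) (auto simp: set_Cons_def list_all2_Cons2)

text \<open>Erdos's box theorem, with ordered tuples as lists. Induction on \<open>k\<close>:
  collect the tails of lists in \<open>S\<close> that can follow at least \<open>t\<close> members
  of a bounded set of first entries, pigeonhole on which \<open>t\<close> members these are, and
  apply the induction hypothesis to the tails common to one such \<open>t\<close>-set.\<close>

lemma dense_lists_contain_box:
  fixes \<delta> :: real and t k :: nat
  assumes "\<delta> > 0"
  shows "\<exists>N. \<forall>(V :: 'a set) S. finite V \<longrightarrow> N \<le> card V \<longrightarrow>
      S \<subseteq> {xs. set xs \<subseteq> V \<and> length xs = k} \<longrightarrow> \<delta> * real (card V) ^ k \<le> real (card S) \<longrightarrow>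
      (\<exists>Ts. length Ts = k \<and> (\<forall>T\<in>set Ts. finite T \<and> card T = t) \<and> listset Ts \<subseteq> S)"
  using assms
proof (induction k arbitrary: \<delta>)
  case 0
  show ?case
  proof (rule exI[of _ 0], intro allI impI)
    fix V :: "'a set" and S
    assume S: "S \<subseteq> {xs. set xs \<subseteq> V \<and> length xs = 0}"
      and "\<delta> * real (card V) ^ 0 \<le> real (card S)"
    then have "S \<noteq> {}" using 0 by auto
    with S have "[] \<in> S" by auto
    then show "\<exists>Ts. length Ts = 0 \<and> (\<forall>T\<in>set Ts. finite T \<and> card T = t) \<and> listset Ts \<subseteq> S"
      by (intro exI[of _ "[]"]) auto
  qed
next
  case (Suc k)
  \<comment> \<open>Large enough that \<open>t\<close> is at most \<open>\<delta> / 4 * m\<close>,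
    which absorbs the tails that follow fewer than \<open>t\<close> members of
    \<open>X\<close>.\<close>
  define m where "m = nat \<lceil>4 * real t / \<delta>\<rceil> + 1"
  have m_ge: "4 * real t / \<delta> \<le> real m" unfolding m_def by linarith
  then have tm: "real t \<le> \<delta> / 4 * real m" using Suc.prems by (simp add: field_simps)
  have m_pos: "m > 0" by (simp add: m_def)
  \<comment> \<open>Tails of density \<open>\<delta> / 4\<close> get distributed over at most
    \<open>2 ^ m\<close> sets; the further factor 2 makes the pigeonhole contradiction
    strict.\<close>
  define \<delta>' where "\<delta>' = \<delta> / (8 * 2 ^ m)"
  have "\<delta>' > 0" using Suc.prems by (simp add: \<delta>'_def)
  from Suc.IH[OF this] obtain N' where N': "\<And>(V :: 'a set) S. finite V \<Longrightarrow> N' \<le> card V \<Longrightarrow>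
      S \<subseteq> {xs. set xs \<subseteq> V \<and> length xs = k} \<Longrightarrow> \<delta>' * real (card V) ^ k \<le> real (card S) \<Longrightarrow>
      (\<exists>Ts. length Ts = k \<and> (\<forall>T\<in>set Ts. finite T \<and> card T = t) \<and> listset Ts \<subseteq> S)"
    by blast
  \<comment> \<open>The second term ensures \<open>m \<le> \<delta> / 2 * n\<close>, so that
    \<open>A\<close> has room for \<open>X\<close>; its \<open>+ 1\<close> gives
    \<open>n > 0\<close>.\<close>
  define N where "N = max N' (nat \<lceil>2 * real m / \<delta>\<rceil> + 1)"
  show ?case
  proof (rule exI[of _ N], intro allI impI)
    fix V :: "'a set" and S
    assume fV: "finite V" and NV: "N \<le> card V"
      and S: "S \<subseteq> {xs. set xs \<subseteq> V \<and> length xs = Suc k}"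
      and dense: "\<delta> * real (card V) ^ Suc k \<le> real (card S)"
    define n where "n = card V"
    have n_pos: "n > 0" and nm: "2 * real m / \<delta> \<le> real n"
      using NV unfolding N_def n_def by linarith+
    define L where "L = {xs. set xs \<subseteq> V \<and> length xs = k}"
    have fL: "finite L" and cL: "card L = n ^ k"
      unfolding L_def n_def using fV by (simp_all add: finite_lists_length_eq card_lists_length_eq)
    define D where "D x = {xs. x # xs \<in> S}" for x
    have DL: "D x \<subseteq> L" for x unfolding D_def L_def using S by fastforce
    have fD: "finite (D x)" for x using DL fL finite_subset by blast
    have cD: "real (card (D x)) \<le> real n ^ k" for x
      using card_mono[OF fL DL[of x]] cL by (metis of_nat_le_iff of_nat_power)
    have "S \<subseteq> (\<lambda>(x, xs). x # xs) ` (SIGMA x:V. D x)"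
    proof
      fix ys assume ys: "ys \<in> S"
      with S obtain x xs where "ys = x # xs" by (cases ys) auto
      then show "ys \<in> (\<lambda>(x, xs). x # xs) ` (SIGMA x:V. D x)"
        using ys S unfolding D_def by (auto intro!: image_eqI[of _ _ "(x, xs)"])
    qed
    then have "card S \<le> card (SIGMA x:V. D x)"
      using fV fD by (meson card_image_le card_mono finite_SigmaI finite_imageI le_trans)
    then have cS: "card S \<le> (\<Sum>x\<in>V. card (D x))"
      using fV fD by simp
    \<comment> \<open>Popular first entries. The others account for at most half of
      \<open>\<delta> * n ^ Suc k\<close>, and each popular one for at most \<open>n ^ k\<close>, so
      at least \<open>\<delta> / 2 * n\<close> entries are popular.\<close>
    define A where "A = {x\<in>V. \<delta> / 2 * real n ^ k \<le> real (card (D x))}"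
    have AV: "A \<subseteq> V" and fA: "finite A" using fV by (auto simp: A_def)
    have "\<delta> * real n ^ Suc k \<le> (\<Sum>x\<in>V. real (card (D x)))"
      using dense cS unfolding n_def by (metis of_nat_le_iff of_nat_sum order_trans)
    also have "\<dots> \<le> (\<Sum>x\<in>V. (if x \<in> A then real n ^ k else 0) + \<delta> / 2 * real n ^ k)"
      using cD Suc.prems by (intro sum_mono) (auto simp: A_def intro: add_increasing2)
    also have "\<dots> = real (card A) * real n ^ k + real n * (\<delta> / 2 * real n ^ k)"
      using AV fV by (simp add: sum.distrib sum.If_cases Int_absorb1 n_def Int_def[symmetric])
    finally have "(\<delta> / 2 * real n) * real n ^ k \<le> real (card A) * real n ^ k"
      by (simp add: algebra_simps)
    then have "\<delta> / 2 * real n \<le> real (card A)"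
      using n_pos by simp
    moreover have "real m \<le> \<delta> / 2 * real n"
      using nm Suc.prems by (simp add: field_simps)
    ultimately have "m \<le> card A" by linarith
    then obtain X where X: "X \<subseteq> A" "card X = m" "finite X"
      by (meson obtain_subset_with_card_n)
    \<comment> \<open>Restricting the first coordinate to a set \<open>X\<close> of bounded size makes pigeonholing over all its subsets affordable.\<close>
    define Y where "Y = {xs\<in>L. t \<le> card {x\<in>X. xs \<in> D x}}"
    have YL: "Y \<subseteq> L" and fY: "finite Y" using fL by (auto simp: Y_def)
    have "real m * (\<delta> / 2 * real n ^ k) \<le> (\<Sum>x\<in>X. real (card (D x)))"
      using X sum_bounded_below[of X "\<delta> / 2 * real n ^ k" "\<lambda>x. real (card (D x))"]
      by (auto simp: A_def)
    also have "\<dots> = real (\<Sum>x\<in>X. card {xs\<in>L. xs \<in> D x})"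
      using DL by (simp add: Int_def[symmetric] Int_absorb1 Collect_conj_eq)
    also have "(\<Sum>x\<in>X. card {xs\<in>L. xs \<in> D x}) = (\<Sum>xs\<in>L. card {x\<in>X. xs \<in> D x})"
      using sum_multicount_gen[OF X(3) fL, of "\<lambda>x xs. xs \<in> D x" "\<lambda>xs. card {x\<in>X. xs \<in> D x}"]
      by simp
    \<comment> \<open>A tail in \<open>Y\<close> is counted at most \<open>m\<close> times, any
      other fewer than \<open>t\<close> times. By the choice of \<open>m\<close>, the terms
      \<open>t\<close> add up to at most half of the lower bound on the whole count.\<close>
    also have "real \<dots> \<le> (\<Sum>xs\<in>L. (if xs \<in> Y then real m else 0) + real t)"
      unfolding of_nat_sum
    proof (rule sum_mono)
      fix xs assume "xs \<in> L"
      moreover have "card {x\<in>X. xs \<in> D x} \<le> m"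
        using X card_mono[OF X(3), of "{x\<in>X. xs \<in> D x}"] by auto
      ultimately show "real (card {x\<in>X. xs \<in> D x}) \<le> (if xs \<in> Y then real m else 0) + real t"
        by (auto simp: Y_def)
    qed
    also have "\<dots> = real (card Y) * real m + real n ^ k * real t"
      using YL fL cL by (simp add: sum.distrib sum.If_cases Int_absorb1 Int_def[symmetric])
    also have "\<dots> \<le> real (card Y) * real m + real n ^ k * (\<delta> / 4 * real m)"
      using tm by (intro add_left_mono mult_left_mono) auto
    finally have "(\<delta> / 4 * real n ^ k) * real m \<le> real (card Y) * real m"
      by (simp add: algebra_simps)
    then have Y_ge: "\<delta> / 4 * real n ^ k \<le> real (card Y)"
      using m_pos by simp
    \<comment> \<open>The tails that may follow every element of \<open>T\<close>: prefixing
      \<open>T\<close> to a box in \<open>R T\<close> yields a box in \<open>S\<close>.\<close>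
    define R where "R T = {xs\<in>L. \<forall>x\<in>T. xs \<in> D x}" for T
    define P where "P = {T. T \<subseteq> X \<and> card T = t}"
    have fP: "finite P" unfolding P_def using X by simp
    have cP: "card P \<le> 2 ^ m"
      using card_mono[of "Pow X" P] X by (auto simp: P_def card_Pow)
    have "Y \<subseteq> (\<Union>T\<in>P. R T)"
    proof
      fix xs assume xs: "xs \<in> Y"
      then obtain T where "T \<subseteq> {x\<in>X. xs \<in> D x}" "card T = t"
        unfolding Y_def by (auto elim: obtain_subset_with_card_n)
      then show "xs \<in> (\<Union>T\<in>P. R T)"
        using xs by (auto simp: Y_def P_def R_def)
    qed
    then have "card Y \<le> card (\<Union>T\<in>P. R T)"
      using fP fL by (intro card_mono) (auto simp: R_def)
    also have "\<dots> \<le> (\<Sum>T\<in>P. card (R T))" by (rule card_UN_le[OF fP])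
    finally have Y_le: "real (card Y) \<le> (\<Sum>T\<in>P. real (card (R T)))"
      by (metis of_nat_le_iff of_nat_sum)
    have "\<exists>T\<in>P. \<delta>' * real n ^ k \<le> real (card (R T))"
    proof (rule ccontr)
      assume "\<not> ?thesis"
      then have "(\<Sum>T\<in>P. real (card (R T))) \<le> (\<Sum>T\<in>P. \<delta>' * real n ^ k)"
        by (intro sum_mono) (auto simp: not_le less_imp_le)
      also have "\<dots> \<le> 2 ^ m * (\<delta>' * real n ^ k)"
        using cP \<open>\<delta>' > 0\<close> by (auto intro!: mult_right_mono simp: of_nat_le_iff[symmetric] simp del: of_nat_le_iff)
      also have "\<dots> = \<delta> / 8 * real n ^ k" by (simp add: \<delta>'_def)
      finally have "\<delta> / 4 * real n ^ k \<le> \<delta> / 8 * real n ^ k" using Y_ge Y_le by linarith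
      then show False using Suc.prems n_pos by simp
    qed
    then obtain T where T: "T \<in> P" "\<delta>' * real n ^ k \<le> real (card (R T))" by blast
    have "R T \<subseteq> {xs. set xs \<subseteq> V \<and> length xs = k}" by (auto simp: R_def L_def)
    from N'[OF fV _ this] T(2) NV obtain Ts where Ts: "length Ts = k"
        "\<forall>T\<in>set Ts. finite T \<and> card T = t" "listset Ts \<subseteq> R T"
      by (auto simp: N_def n_def)
    have "listset (T # Ts) \<subseteq> S"
      using Ts(3) by (auto simp: set_Cons_def R_def D_def)
    moreover have "finite T \<and> card T = t"
      using T(1) X(3) by (auto simp: P_def intro: finite_subset)
    ultimately show "\<exists>Ts. length Ts = Suc k \<and> (\<forall>T\<in>set Ts. finite T \<and> card T = t) \<and> listset Ts \<subseteq> S"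
      using Ts by (intro exI[of _ "T # Ts"]) auto
  qed
qed

section \<open>Ordered suspended cliques\<close>

text \<open>The ordered \<open>k\<close>-cliques in the link graph of \<open>set ys\<close>, kept as
  lists so that the box theorem applies to them directly.\<close>

definition suspended_cliques :: "'b hypergraph \<Rightarrow> nat \<Rightarrow> 'b list \<Rightarrow> 'b list set" where
  "suspended_cliques H k ys = {xs. length xs = k \<and> distinct (ys @ xs) \<and> set (ys @ xs) \<subseteq> verts H \<and>
     (\<forall>i<k. \<forall>j<k. i \<noteq> j \<longrightarrow> {xs ! i, xs ! j} \<union> set ys \<in> edges H)}"

text \<open>Colour class \<open>i\<close> of \<open>F\<close> is mapped injectively into
  \<open>Ts ! i\<close>. Vertices of different colours lie on a common transversal of the box, so
  their images are distinct and form an edge together with \<open>ys\<close>; the new vertices go to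
  \<open>ys\<close>.\<close>

lemma contains_suspension_if_box:
  fixes F :: "'a hypergraph" and H :: "'b hypergraph"
  assumes F: "simple_graph F" and c: "proper_colouring F k c"
    and ys: "length ys = r - 2" and Ts: "length Ts = k"
    and T: "\<And>T. T \<in> set Ts \<Longrightarrow> finite T \<and> T \<noteq> {} \<and> card (verts F) \<le> card T"
    and box: "listset Ts \<subseteq> suspended_cliques H k ys"
  shows "contains_copy H (suspension r F)"
proof -
  have fF: "finite (verts F)" using F by (simp add: uniform_hypergraph_def)
  have ck: "c v < k" if "v \<in> verts F" for v
    using c that by (auto simp: proper_colouring_def)
  have "\<exists>h. inj_on h (verts F) \<and> h ` verts F \<subseteq> Ts ! i" if "i < k" for i
    using T[of "Ts ! i"] that Ts fF card_le_inj[of "verts F" "Ts ! i"] by auto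
  then obtain h where h: "\<And>i. i < k \<Longrightarrow> inj_on (h i) (verts F)"
      "\<And>i. i < k \<Longrightarrow> h i ` verts F \<subseteq> Ts ! i" by metis
  define g where "g v = h (c v) v" for v
  have gT: "g v \<in> Ts ! c v" if "v \<in> verts F" for v
    using h(2)[OF ck] that by (auto simp: g_def)
  \<comment> \<open>A default transversal. Overwriting it at one or two colours gives cliques
    through prescribed images, and its own membership shows that \<open>ys\<close> is distinct even
    when \<open>F\<close> has no vertices.\<close>
  define zs where "zs = map (\<lambda>T. SOME x. x \<in> T) Ts"
  have zs: "length zs = k" "\<And>i. i < k \<Longrightarrow> zs ! i \<in> Ts ! i"
    using T Ts by (auto simp: zs_def some_in_eq)
  have clique: "xs \<in> suspended_cliques H k ys" if "length xs = k" "\<And>i. i < k \<Longrightarrow> xs ! i \<in> Ts ! i" for xs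
    using box that Ts by (auto simp: in_listset_iff list_all2_conv_all_nth)
  have ys_ok: "distinct ys" "set ys \<subseteq> verts H"
    using clique[OF zs] by (auto simp: suspended_cliques_def)
  have single: "g v \<in> verts H \<and> g v \<notin> set ys" if v: "v \<in> verts F" for v
  proof -
    have "zs[c v := g v] \<in> suspended_cliques H k ys"
      using zs gT[OF v] ck[OF v] by (intro clique) (simp_all add: nth_list_update, blast)
    moreover have "g v \<in> set (zs[c v := g v])"
      using zs ck[OF v] by (simp add: set_update_memI)
    ultimately show ?thesis by (auto simp: suspended_cliques_def)
  qed
  have pair: "g u \<noteq> g v \<and> {g u, g v} \<union> set ys \<in> edges H"
    if u: "u \<in> verts F" and v: "v \<in> verts F" and uv: "c u \<noteq> c v" for u v
  proof -
    define xs where "xs = zs[c u := g u, c v := g v]"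
    have "xs \<in> suspended_cliques H k ys"
      using zs gT[OF u] gT[OF v] ck[OF u] ck[OF v]
      unfolding xs_def by (intro clique) (simp_all add: nth_list_update, blast)
    then have "xs ! c u \<noteq> xs ! c v" "{xs ! c u, xs ! c v} \<union> set ys \<in> edges H"
      using ck[OF u] ck[OF v] uv unfolding suspended_cliques_def
      by (simp_all add: nth_eq_iff_index_eq)
    moreover have "xs ! c u = g u" "xs ! c v = g v"
      using zs ck[OF u] ck[OF v] uv by (auto simp: xs_def)
    ultimately show ?thesis by simp
  qed
  have g_inj: "u = v" if "u \<in> verts F" "v \<in> verts F" "g u = g v" for u v
    using pair[OF that(1,2)] that h(1)[OF ck[OF that(1)]]
    by (metis g_def inj_onD)
  define f where "f = case_sum g (\<lambda>i. ys ! i)"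
  have f_ys: "f ` Inr ` {..<r - 2} = set ys"
    using ys by (auto simp: f_def image_iff in_set_conv_nth)
  have "inj_on f (verts (suspension r F))"
    unfolding inj_on_def suspension_def f_def
    using g_inj single ys ys_ok(1) by (auto simp: nth_eq_iff_index_eq, (metis nth_mem)+)
  moreover have "f ` verts (suspension r F) \<subseteq> verts H"
    using single ys_ok f_ys by (auto simp: suspension_def image_Un f_def)
  moreover have "f ` e \<in> edges H" if e: "e \<in> edges (suspension r F)" for e
  proof -
    obtain a where a: "a \<in> edges F" "e = Inl ` a \<union> Inr ` {..<r - 2}"
      using e by (auto simp: suspension_def)
    then have "a \<subseteq> verts F" "card a = 2" using F by (auto simp: uniform_hypergraph_def)
    then obtain u v where uv: "a = {u, v}" "u \<in> verts F" "v \<in> verts F"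
      by (auto simp: card_2_iff)
    then have "c u \<noteq> c v" using a c by (auto simp: proper_colouring_def)
    moreover have "f ` e = {g u, g v} \<union> set ys"
      unfolding a(2) image_Un f_ys using uv by (simp add: f_def)
    ultimately show ?thesis using pair[of u v] uv by simp
  qed
  ultimately show ?thesis unfolding contains_copy_def by blast
qed

text \<open>Listing the images of the new vertices and of the clique vertices gives
  \<open>ys\<close> and \<open>xs\<close>. This links freeness from the suspension of
  \<open>complete_graph k\<close> to the absence of ordered cliques.\<close>

lemma copy_of_suspended_clique:
  assumes "contains_copy H (suspension r (complete_graph k))"
  obtains ys xs where "length ys = r - 2" "xs \<in> suspended_cliques H k ys"
proof -
  obtain f where f: "inj_on f (verts (suspension r (complete_graph k)))"
      "f ` verts (suspension r (complete_graph k)) \<subseteq> verts H"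
      "\<And>e. e \<in> edges (suspension r (complete_graph k)) \<Longrightarrow> f ` e \<in> edges H"
    using assms by (auto simp: contains_copy_def)
  have V: "verts (suspension r (complete_graph k)) = Inl ` {..<k} \<union> Inr ` {..<r - 2}"
    by (simp add: suspension_def complete_graph_def)
  define ys where "ys = map (\<lambda>i. f (Inr i)) [0..<r - 2]"
  define xs where "xs = map (\<lambda>i. f (Inl i)) [0..<k]"
  have "distinct (ys @ xs)"
    by (auto simp: ys_def xs_def distinct_map inj_on_def image_iff
        inj_on_eq_iff[OF f(1), unfolded V])
  moreover have "set (ys @ xs) \<subseteq> verts H"
    using f(2) unfolding V by (auto simp: ys_def xs_def)
  moreover have "{xs ! i, xs ! j} \<union> set ys \<in> edges H" if "i < k" "j < k" "i \<noteq> j" for i j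
  proof -
    have "Inl ` {i, j} \<union> Inr ` {..<r - 2} \<in> edges (suspension r (complete_graph k))"
      unfolding suspension_def complete_graph_def using that
      by (auto intro!: image_eqI[of _ _ "{i, j}"])
    from f(3)[OF this] show ?thesis
      using that by (simp add: image_Un image_image xs_def ys_def atLeast0LessThan)
  qed
  ultimately have "xs \<in> suspended_cliques H k ys"
    by (auto simp: suspended_cliques_def xs_def)
  then show thesis by (intro that[of ys xs]) (auto simp: ys_def)
qed

text \<open>Vertex sets of suspended cliques, forgetting the order and the split into
  \<open>ys\<close> and \<open>xs\<close>. They all have size \<open>k + (r - 2)\<close>, so they
  can be averaged over \<open>m\<close>-sets just like edges.\<close>

definition clique_supports :: "'b hypergraph \<Rightarrow> nat \<Rightarrow> nat \<Rightarrow> 'b set set" where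
  "clique_supports H r k = {set (ys @ xs) | ys xs. length ys = r - 2 \<and> xs \<in> suspended_cliques H k ys}"

lemma clique_supports_subset:
  "Z \<in> clique_supports H r k \<Longrightarrow> Z \<subseteq> verts H \<and> card Z = k + (r - 2)"
  by (auto simp: clique_supports_def suspended_cliques_def distinct_card simp flip: set_append)

text \<open>A tuple \<open>ys\<close> with more than \<open>\<delta> * n ^ k\<close> cliques in its
  link would yield a box and hence a copy of the suspension of \<open>F\<close>. Summing over the
  \<open>n ^ (r - 2)\<close> tuples gives the bound.\<close>

lemma few_clique_supports:
  fixes F :: "'a hypergraph" and \<delta> :: real
  assumes "simple_graph F" "proper_colouring F k c" "\<delta> > 0"
  shows "\<exists>N. \<forall>H :: 'b hypergraph. finite (verts H) \<longrightarrow> N \<le> card (verts H) \<longrightarrow>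
    \<not> contains_copy H (suspension r F) \<longrightarrow>
    real (card (clique_supports H r k)) \<le> \<delta> * real (card (verts H)) ^ (k + (r - 2))"
proof -
  \<comment> \<open>\<open>Suc\<close> keeps the sides of the box nonempty even if \<open>F\<close>
    has no vertices.\<close>
  define t where "t = Suc (card (verts F))"
  from dense_lists_contain_box[OF assms(3), of k t] obtain N where N:
    "\<And>(V :: 'b set) S. finite V \<Longrightarrow> N \<le> card V \<Longrightarrow>
      S \<subseteq> {xs. set xs \<subseteq> V \<and> length xs = k} \<Longrightarrow> \<delta> * real (card V) ^ k \<le> real (card S) \<Longrightarrow>
      (\<exists>Ts. length Ts = k \<and> (\<forall>T\<in>set Ts. finite T \<and> card T = t) \<and> listset Ts \<subseteq> S)"
    by blast
  show ?thesis
  proof (rule exI[of _ N], intro allI impI)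
    fix H :: "'b hypergraph"
    assume fH: "finite (verts H)" and NH: "N \<le> card (verts H)"
      and free: "\<not> contains_copy H (suspension r F)"
    define n where "n = card (verts H)"
    have sub: "suspended_cliques H k ys \<subseteq> {xs. set xs \<subseteq> verts H \<and> length xs = k}" for ys
      by (auto simp: suspended_cliques_def)
    have fin: "finite (suspended_cliques H k ys)" for ys
      using finite_subset[OF sub finite_lists_length_eq[OF fH]] .
    have small: "real (card (suspended_cliques H k ys)) \<le> \<delta> * real n ^ k" if "length ys = r - 2" for ys
    proof (rule ccontr)
      assume "\<not> ?thesis"
      then obtain Ts where Ts: "length Ts = k" "\<forall>T\<in>set Ts. finite T \<and> card T = t"
          "listset Ts \<subseteq> suspended_cliques H k ys"
        using N[OF fH NH sub, of ys] by (auto simp: n_def)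
      have "contains_copy H (suspension r F)"
        using Ts(2) by (intro contains_suspension_if_box[OF assms(1,2) that Ts(1) _ Ts(3)]) (auto simp: t_def)
      with free show False ..
    qed
    define Q where "Q = {ys. set ys \<subseteq> verts H \<and> length ys = r - 2}"
    have fQ: "finite Q" and cQ: "card Q = n ^ (r - 2)"
      unfolding Q_def n_def using fH by (simp_all add: finite_lists_length_eq card_lists_length_eq)
    have "clique_supports H r k \<subseteq> (\<lambda>(ys, xs). set (ys @ xs)) ` (SIGMA ys:Q. suspended_cliques H k ys)"
      by (force simp: clique_supports_def Q_def suspended_cliques_def)
    then have "card (clique_supports H r k) \<le> card (SIGMA ys:Q. suspended_cliques H k ys)"
      using fQ fin by (meson card_image_le card_mono finite_SigmaI finite_imageI le_trans)
    also have "\<dots> = (\<Sum>ys\<in>Q. card (suspended_cliques H k ys))" using fQ fin by simp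
    finally have "real (card (clique_supports H r k)) \<le> (\<Sum>ys\<in>Q. real (card (suspended_cliques H k ys)))"
      by (metis of_nat_le_iff of_nat_sum)
    also have "\<dots> \<le> (\<Sum>ys\<in>Q. \<delta> * real n ^ k)"
      using small by (intro sum_mono) (auto simp: Q_def)
    also have "\<dots> = \<delta> * real n ^ (k + (r - 2))"
      using cQ by (simp add: power_add)
    finally show "real (card (clique_supports H r k)) \<le> \<delta> * real (card (verts H)) ^ (k + (r - 2))"
      by (simp add: n_def)
  qed
qed

section \<open>Averaging over induced subhypergraphs\<close>

lemma card_supersets_of_size:
  assumes "finite V" "e \<subseteq> V" "card e \<le> m"
  shows "card {W. W \<subseteq> V \<and> card W = m \<and> e \<subseteq> W} = (card V - card e) choose (m - card e)"
proof -
  have fe: "finite e" using assms finite_subset by blast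
  have "bij_betw (\<lambda>U. U \<union> e) {U. U \<subseteq> V - e \<and> card U = m - card e}
     {W. W \<subseteq> V \<and> card W = m \<and> e \<subseteq> W}"
  proof (rule bij_betw_byWitness[where f' = "\<lambda>W. W - e"])
    show "(\<lambda>U. U \<union> e) ` {U. U \<subseteq> V - e \<and> card U = m - card e} \<subseteq> {W. W \<subseteq> V \<and> card W = m \<and> e \<subseteq> W}"
    proof safe
      fix U assume U: "U \<subseteq> V - e" "card U = m - card e"
      have "card (U \<union> e) = card U + card e"
        using U assms fe by (intro card_Un_disjoint) (auto intro: finite_subset)
      then show "card (U \<union> e) = m" using U assms by simp
    qed (use assms in auto)
    show "(\<lambda>W. W - e) ` {W. W \<subseteq> V \<and> card W = m \<and> e \<subseteq> W} \<subseteq> {U. U \<subseteq> V - e \<and> card U = m - card e}"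
      using fe by (auto simp: card_Diff_subset)
  qed auto
  then have "card {W. W \<subseteq> V \<and> card W = m \<and> e \<subseteq> W} = card {U. U \<subseteq> V - e \<and> card U = m - card e}"
    by (simp add: bij_betw_same_card)
  also have "\<dots> = card (V - e) choose (m - card e)" using assms by (simp add: n_subsets)
  finally show ?thesis using assms fe by (simp add: card_Diff_subset)
qed

text \<open>Double counting of pairs of a member and an \<open>m\<close>-set around it, combined
  with the identity \<open>choose_mult\<close>. In effect, the density of \<open>E\<close> in
  \<open>V\<close> is its average density in \<open>m\<close>-subsets; clearing denominators keeps
  the identity in \<open>nat\<close>.\<close>

lemma sum_card_members_inside:
  assumes V: "finite V" and E: "\<And>e. e \<in> E \<Longrightarrow> e \<subseteq> V \<and> card e = s"
    and sm: "s \<le> m" and mV: "m \<le> card V"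
  shows "(\<Sum>W | W \<subseteq> V \<and> card W = m. card {e\<in>E. e \<subseteq> W}) * (card V choose s)
       = card E * (m choose s) * (card V choose m)"
proof -
  have fE: "finite E" using E V by (meson Pow_iff finite_Pow_iff finite_subset subsetI)
  have fM: "finite {W. W \<subseteq> V \<and> card W = m}" using V by simp
  have "(\<Sum>W | W \<subseteq> V \<and> card W = m. card {e\<in>E. e \<subseteq> W})
      = (\<Sum>e\<in>E. (card V - s) choose (m - s))"
    using card_supersets_of_size[OF V] E sm
    by (intro sum_multicount_gen[OF fM fE, of "\<lambda>W e. e \<subseteq> W"]) (auto simp: conj_assoc)
  then show ?thesis using choose_mult[OF sm mV] by (simp add: algebra_simps)
qed

section \<open>The extremal function\<close>

lemma card_edges_le_ex:
  fixes G :: "nat hypergraph"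
  assumes "uniform_hypergraph r G" "card (verts G) = n" "\<not> contains_copy G K"
  shows "card (edges G) \<le> ex r n K"
proof -
  have "card (edges H) \<le> 2 ^ n"
    if "uniform_hypergraph r H" "card (verts H) = n" for H :: "nat hypergraph"
    using that card_mono[of "Pow (verts H)" "edges H"] by (auto simp: uniform_hypergraph_def card_Pow)
  then have "bdd_above {card (edges G) | G :: nat hypergraph.
     uniform_hypergraph r G \<and> card (verts G) = n \<and> \<not> contains_copy G K}"
    by (intro bdd_aboveI[of _ "2 ^ n"]) auto
  then show ?thesis unfolding ex_def using assms by (intro cSup_upper) auto
qed

text \<open>Nonnegativity of \<open>b\<close> handles the case of no \<open>K\<close>-free
  hypergraph, where \<open>ex\<close> is the supremum of the empty set, which is 0 in
  \<open>nat\<close>.\<close>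

lemma ex_le:
  assumes "\<And>G :: nat hypergraph. uniform_hypergraph r G \<Longrightarrow> card (verts G) = n \<Longrightarrow>
      \<not> contains_copy G K \<Longrightarrow> real (card (edges G)) \<le> b" and "0 \<le> b"
  shows "real (ex r n K) \<le> b"
proof -
  let ?A = "{card (edges G) | G :: nat hypergraph.
     uniform_hypergraph r G \<and> card (verts G) = n \<and> \<not> contains_copy G K}"
  have "ex r n K \<le> nat \<lfloor>b\<rfloor>"
  proof (cases "?A = {}")
    case True
    then show ?thesis unfolding ex_def True by simp
  next
    case False
    then show ?thesis unfolding ex_def using assms by (intro cSup_least) (auto simp: le_nat_floor)
  qed
  then show ?thesis using assms(2) by linarith
qed

section \<open>Induced subhypergraphs and edge densities\<close>

definition induced :: "'b hypergraph \<Rightarrow> 'b set \<Rightarrow> 'b hypergraph" where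
  "induced G W = Hypergraph W {e \<in> edges G. e \<subseteq> W}"

lemma uniform_hypergraph_induced:
  "uniform_hypergraph r G \<Longrightarrow> W \<subseteq> verts G \<Longrightarrow> uniform_hypergraph r (induced G W)"
  by (auto simp: uniform_hypergraph_def induced_def intro: finite_subset)

lemma contains_copy_induced:
  "contains_copy (induced G W) K \<Longrightarrow> W \<subseteq> verts G \<Longrightarrow> contains_copy G K"
  unfolding contains_copy_def induced_def by (auto; blast)

lemma suspended_cliques_induced:
  "W \<subseteq> verts G \<Longrightarrow> xs \<in> suspended_cliques (induced G W) k ys \<Longrightarrow>
    xs \<in> suspended_cliques G k ys \<and> set (ys @ xs) \<subseteq> W"
  by (auto simp: suspended_cliques_def induced_def)

text \<open>Average over the \<open>m\<close>-subsets \<open>W\<close>. If \<open>W\<close> induces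
  no copy of the suspended clique, it spans at most \<open>ex r m\<close> edges. Otherwise it spans
  at most \<open>m choose r\<close> edges and contains at least one support, so charging
  \<open>m choose r\<close> to each support inside \<open>W\<close> covers both cases.\<close>

lemma edge_density_le:
  fixes G :: "nat hypergraph"
  assumes G: "uniform_hypergraph r G" and n: "card (verts G) = n"
    and m: "r \<le> m" "k + (r - 2) \<le> m" "m \<le> n"
  shows "real (card (edges G)) / real (n choose r)
    \<le> real (ex r m (suspension r (complete_graph k))) / real (m choose r)
      + real (card (clique_supports G r k)) * real (m choose (k + (r - 2))) / real (n choose (k + (r - 2)))"
    (is "_ \<le> ?x / _ + real (card ?Z) * real (m choose ?v) / _")
proof -
  define M where "M = {W. W \<subseteq> verts G \<and> card W = m}"
  have fV: "finite (verts G)" and edge: "\<And>e. e \<in> edges G \<Longrightarrow> e \<subseteq> verts G \<and> card e = r"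
    using G by (auto simp: uniform_hypergraph_def)
  have cM: "card M = n choose m" unfolding M_def using fV n by (simp add: n_subsets)
  have fZ: "finite ?Z"
    using clique_supports_subset fV by (meson Pow_iff finite_Pow_iff finite_subset subsetI)
  have pos: "real (n choose m) > 0" "real (m choose r) > 0" "real (n choose r) > 0" "real (n choose ?v) > 0"
    using m by simp_all
  have le: "card {e\<in>edges G. e \<subseteq> W}
      \<le> ex r m (suspension r (complete_graph k)) + (m choose r) * card {Z\<in>?Z. Z \<subseteq> W}"
    if W: "W \<in> M" for W
  proof (cases "contains_copy (induced G W) (suspension r (complete_graph k))")
    case True
    then obtain ys xs where "length ys = r - 2" "xs \<in> suspended_cliques (induced G W) k ys"
      by (rule copy_of_suspended_clique)
    then have "set (ys @ xs) \<in> {Z\<in>?Z. Z \<subseteq> W}"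
      using suspended_cliques_induced[of W G xs k ys] W unfolding M_def clique_supports_def by blast
    then have "{Z\<in>?Z. Z \<subseteq> W} \<noteq> {}" by blast
    then have "card {Z\<in>?Z. Z \<subseteq> W} \<ge> 1"
      using fZ by (simp add: Suc_le_eq card_gt_0_iff)
    moreover have "card {e\<in>edges G. e \<subseteq> W} \<le> m choose r"
    proof -
      have fW: "finite W" "card W = m" using W fV by (auto simp: M_def intro: finite_subset)
      then have "card {e\<in>edges G. e \<subseteq> W} \<le> card {e. e \<subseteq> W \<and> card e = r}"
        using edge by (intro card_mono) auto
      then show ?thesis using fW by (simp add: n_subsets)
    qed
    ultimately have "card {e\<in>edges G. e \<subseteq> W} * 1 \<le> (m choose r) * card {Z\<in>?Z. Z \<subseteq> W}"
      by (rule mult_le_mono[rotated])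
    then show ?thesis by simp
  next
    case False
    then have "card (edges (induced G W)) \<le> ex r m (suspension r (complete_graph k))"
      using W uniform_hypergraph_induced[OF G, of W]
      by (intro card_edges_le_ex) (auto simp: M_def induced_def)
    then show ?thesis by (simp add: induced_def)
  qed
  define sE where "sE = (\<Sum>W\<in>M. card {e\<in>edges G. e \<subseteq> W})"
  define sZ where "sZ = (\<Sum>W\<in>M. card {Z\<in>?Z. Z \<subseteq> W})"
  have "sE * (n choose r) = card (edges G) * (m choose r) * (n choose m)"
    unfolding sE_def M_def using sum_card_members_inside[OF fV edge] m n by simp
  then have sE: "real sE = real (card (edges G)) * real (m choose r) * real (n choose m) / real (n choose r)"
    using pos by (simp add: field_simps flip: of_nat_mult)
  have "sZ * (n choose ?v) = card ?Z * (m choose ?v) * (n choose m)"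
    unfolding sZ_def M_def
    using sum_card_members_inside[of "verts G" ?Z ?v m] clique_supports_subset[of _ G r k] fV m n
    by simp
  then have sZ: "real sZ = real (card ?Z) * real (m choose ?v) * real (n choose m) / real (n choose ?v)"
    using pos by (simp add: field_simps flip: of_nat_mult)
  have "sE \<le> (\<Sum>W\<in>M. ex r m (suspension r (complete_graph k)) + (m choose r) * card {Z\<in>?Z. Z \<subseteq> W})"
    unfolding sE_def using le by (rule sum_mono)
  also have "\<dots> = (n choose m) * ex r m (suspension r (complete_graph k)) + (m choose r) * sZ"
    by (simp add: sum.distrib cM sZ_def sum_distrib_left)
  finally have "real sE \<le> real (n choose m) * ?x + real (m choose r) * real sZ"
    by (simp flip: of_nat_mult of_nat_add)
  then have "real sE / (real (n choose m) * real (m choose r))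
      \<le> (real (n choose m) * ?x + real (m choose r) * real sZ) / (real (n choose m) * real (m choose r))"
    by (rule divide_right_mono) simp
  also have "\<dots> = ?x / real (m choose r) + real sZ / real (n choose m)"
    using pos by (simp add: field_simps)
  finally show ?thesis
    unfolding sE sZ using pos by (simp add: field_simps)
qed

text \<open>The Katona-Nemetz-Simonovits averaging argument: the density of a \<open>K\<close>-free
  hypergraph is the average density of its induced subhypergraphs on \<open>m\<close> vertices,
  which are \<open>K\<close>-free as well.\<close>

lemma ex_density_antimono:
  assumes "r \<le> m" "m \<le> n"
  shows "real (ex r n K) / real (n choose r) \<le> real (ex r m K) / real (m choose r)"
proof -
  have pos: "real (n choose m) > 0" "real (m choose r) > 0" "real (n choose r) > 0"
    using assms by simp_all
  have "real (ex r n K) \<le> real (ex r m K) / real (m choose r) * real (n choose r)"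
  proof (rule ex_le)
    fix G :: "nat hypergraph"
    assume G: "uniform_hypergraph r G" "card (verts G) = n" "\<not> contains_copy G K"
    define M where "M = {W. W \<subseteq> verts G \<and> card W = m}"
    have fV: "finite (verts G)" and edge: "\<And>e. e \<in> edges G \<Longrightarrow> e \<subseteq> verts G \<and> card e = r"
      using G by (auto simp: uniform_hypergraph_def)
    have cM: "card M = n choose m" unfolding M_def using fV G by (simp add: n_subsets)
    have "card {e\<in>edges G. e \<subseteq> W} \<le> ex r m K" if "W \<in> M" for W
    proof -
      have "card (edges (induced G W)) \<le> ex r m K"
        using that uniform_hypergraph_induced[OF G(1), of W] contains_copy_induced[of G W K] G(3)
        by (intro card_edges_le_ex) (auto simp: M_def induced_def)
      then show ?thesis by (simp add: induced_def)
    qed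
    then have "(\<Sum>W\<in>M. card {e\<in>edges G. e \<subseteq> W}) \<le> (n choose m) * ex r m K"
      using sum_bounded_above[of M "\<lambda>W. card {e\<in>edges G. e \<subseteq> W}"] cM by simp
    then have "(\<Sum>W\<in>M. card {e\<in>edges G. e \<subseteq> W}) * (n choose r) \<le> (n choose m) * ex r m K * (n choose r)"
      by (rule mult_le_mono1)
    moreover have "(\<Sum>W\<in>M. card {e\<in>edges G. e \<subseteq> W}) * (n choose r)
        = card (edges G) * (m choose r) * (n choose m)"
      using sum_card_members_inside[OF fV edge assms(1)] assms(2) G(2) by (simp add: M_def)
    ultimately have "card (edges G) * (m choose r) * (n choose m) \<le> (n choose m) * ex r m K * (n choose r)"
      by simp
    then have "card (edges G) * (m choose r) \<le> ex r m K * (n choose r)"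
      using pos by (simp add: mult.commute mult.left_commute)
    then have "real (card (edges G)) * real (m choose r) \<le> real (ex r m K) * real (n choose r)"
      by (simp flip: of_nat_mult)
    then show "real (card (edges G)) \<le> real (ex r m K) / real (m choose r) * real (n choose r)"
      using pos by (simp add: field_simps)
  qed simp
  then show ?thesis using pos by (simp add: field_simps)
qed

section \<open>Choice of constants and the asymptotic comparison\<close>

lemma ex_suspension_eventually_le:
  fixes F :: "'a hypergraph" and \<epsilon> :: real
  assumes F: "simple_graph F" "proper_colouring F k c" and "\<epsilon> > 0"
  shows "\<exists>N. \<forall>n\<ge>N. real (ex r n (suspension r F))
    \<le> real (ex r n (suspension r (complete_graph k))) + \<epsilon> * real n ^ r"
proof -
  define K where "K = suspension r (complete_graph k)"
  define v where "v = k + (r - 2)"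
  define dens where "dens n = real (ex r n K) / real (n choose r)" for n
  \<comment> \<open>Once \<open>dens m\<close> is within \<open>\<epsilon> / 2\<close> of the
    infimum, \<open>dens m < dens n + \<epsilon> / 2\<close> holds for every
    \<open>n \<ge> m\<close>.\<close>
  define \<pi> where "\<pi> = (INF n\<in>{max r v..}. dens n)"
  have bdd: "bdd_below (dens ` {max r v..})"
    by (intro bdd_belowI2[of _ 0]) (simp add: dens_def)
  obtain m where m: "r \<le> m" "v \<le> m" "dens m < \<pi> + \<epsilon> / 2"
  proof -
    have "\<exists>y\<in>dens ` {max r v..}. y < \<pi> + \<epsilon> / 2"
      using \<open>\<epsilon> > 0\<close> by (intro cInf_lessD) (auto simp: \<pi>_def)
    then show thesis using that by auto
  qed
  \<comment> \<open>Chosen after \<open>m\<close>, so that the support term of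
    \<open>edge_density_le\<close> is at most \<open>\<epsilon> / 2\<close>; the factor
    \<open>v ^ v\<close> comes from \<open>n ^ v \<le> v ^ v * (n choose v)\<close>. For
    \<open>v = 0\<close> it equals 1.\<close>
  define \<delta> where "\<delta> = \<epsilon> / (2 * (real v ^ v * real (m choose v)))"
  have vpos: "real v ^ v * real (m choose v) > 0"
    using m by (cases "v = 0") auto
  then have "\<delta> > 0" using \<open>\<epsilon> > 0\<close> by (simp add: \<delta>_def)
  from few_clique_supports[OF F this, of r] obtain N where N:
    "\<And>H :: nat hypergraph. finite (verts H) \<Longrightarrow> N \<le> card (verts H) \<Longrightarrow>
      \<not> contains_copy H (suspension r F) \<Longrightarrow>
      real (card (clique_supports H r k)) \<le> \<delta> * real (card (verts H)) ^ v"
    unfolding v_def by blast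
  show ?thesis
  proof (rule exI[of _ "max N m"], intro allI impI, rule ex_le)
    fix n and G :: "nat hypergraph"
    assume n: "max N m \<le> n"
      and G: "uniform_hypergraph r G" "card (verts G) = n" "\<not> contains_copy G (suspension r F)"
    have fV: "finite (verts G)" using G by (simp add: uniform_hypergraph_def)
    have pos: "real (n choose r) > 0" "real (n choose v) > 0" using m n by simp_all
    have "\<pi> \<le> dens n"
      unfolding \<pi>_def using m n by (intro cINF_lower[OF bdd]) auto
    have "real n ^ v \<le> real v ^ v * real (n choose v)"
      using binomial_ge_n_over_k_pow_k[of v n, where 'a=real] m n
      by (cases "v = 0") (auto simp: power_divide field_simps)
    then have "\<delta> * real n ^ v \<le> \<delta> * (real v ^ v * real (n choose v))"
      using \<open>\<delta> > 0\<close> by simp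
    then have "real (card (clique_supports G r k)) \<le> \<delta> * (real v ^ v * real (n choose v))"
      using N[OF fV _ G(3)] G(2) n by simp
    then have "real (card (clique_supports G r k)) * real (m choose v)
        \<le> \<delta> * (real v ^ v * real (n choose v)) * real (m choose v)"
      by (rule mult_right_mono) simp
    also have "\<dots> = \<epsilon> / 2 * real (n choose v)"
      using vpos m by (simp add: \<delta>_def)
    finally have "real (card (clique_supports G r k)) * real (m choose v) / real (n choose v) \<le> \<epsilon> / 2"
      using pos by (simp add: field_simps)
    moreover have "real (card (edges G)) / real (n choose r)
        \<le> dens m + real (card (clique_supports G r k)) * real (m choose v) / real (n choose v)"
      unfolding dens_def K_def v_def using m n G by (intro edge_density_le) (auto simp: v_def)
    ultimately have "real (card (edges G)) / real (n choose r) \<le> dens n + \<epsilon>"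
      using m(3) \<open>\<pi> \<le> dens n\<close> by linarith
    then have "real (card (edges G)) \<le> real (ex r n K) + \<epsilon> * real (n choose r)"
      using pos by (simp add: dens_def field_simps)
    also have "real (n choose r) \<le> real n ^ r"
      using m n binomial_le_pow[of r n] by (simp flip: of_nat_power)
    finally show "real (card (edges G))
        \<le> real (ex r n (suspension r (complete_graph k))) + \<epsilon> * real n ^ r"
      using \<open>\<epsilon> > 0\<close> by (simp add: K_def)
  qed (use \<open>\<epsilon> > 0\<close> in simp)
qed

text \<open>The \<open>LEAST\<close> in \<open>chromatic_number\<close> needs some proper colouring
  to exist; numbering the vertices injectively is one, since an edge has two distinct ends.\<close>

lemma proper_colouring_chromatic_number:
  assumes "simple_graph F"
  shows "\<exists>c. proper_colouring F (chromatic_number F) c"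
proof -
  have fin: "finite (verts F)" using assms by (simp add: uniform_hypergraph_def)
  then obtain c where c: "bij_betw c (verts F) {..<card (verts F)}"
    using ex_bij_betw_finite_nat by (metis atLeast0LessThan)
  have "c u \<noteq> c w" if "{u, w} \<in> edges F" for u w
  proof -
    have "{u, w} \<subseteq> verts F" "card {u, w} = 2" using that assms by (auto simp: uniform_hypergraph_def)
    then show ?thesis using c by (auto simp: bij_betw_def inj_on_def card_insert_if split: if_splits)
  qed
  then have "proper_colouring F (card (verts F)) c"
    using c by (auto simp: proper_colouring_def bij_betw_def)
  then show ?thesis
    unfolding chromatic_number_def by (intro LeastI[of "\<lambda>k. \<exists>c. proper_colouring F k c"]) blast
qed

theorem theorem1p2:
  fixes F :: "'a hypergraph" and r k :: nat
  assumes "r \<ge> 2"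
    and "simple_graph F"
    and "chromatic_number F = k"
  shows "\<exists>g :: nat \<Rightarrow> real. g \<in> o(\<lambda>n. real n ^ r) \<and>
    (\<forall>n. real (ex r n (suspension r F)) \<le> real (ex r n (suspension r (complete_graph k))) + g n)"
proof -
  \<comment> \<open>The positive part of the difference: the inequality then holds for every
    \<open>n\<close>, and the upper bounds valid for large \<open>n\<close> suffice to control
    \<open>norm (g n)\<close>.\<close>
  define g where "g n = max 0 (real (ex r n (suspension r F))
      - real (ex r n (suspension r (complete_graph k))))" for n
  obtain c where c: "proper_colouring F k c"
    using proper_colouring_chromatic_number[OF assms(2)] assms(3) by blast
  have "g \<in> o(\<lambda>n. real n ^ r)"
  proof (rule landau_o.smallI)
    fix \<epsilon> :: real assume "\<epsilon> > 0"
    with ex_suspension_eventually_le[OF assms(2) c this, of r]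
    show "\<forall>\<^sub>F n in sequentially. norm (g n) \<le> \<epsilon> * norm (real n ^ r)"
      by (force simp: eventually_sequentially g_def)
  qed
  then show ?thesis by (intro exI[of _ g]) (auto simp: g_def)
qed

end
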